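(* Let $G$ be a connected nilpotent Lie group. Then an element $g \in G$ is real if and only if $g^2 = e$. Equivalently, the set of real elements of $G$ is precisely $G[2] = \{g \in G : g^2 = e\}$. In particular, $G[2] \subset Z(G)$, and if $G$ is simply connected nilpotent then the identity element is the only real element of $G$.
   Context: An element $g$ of a group $G$ is \emph{real} if it is conjugate in $G$ to $g^{-1}$. $Z(G)$ denotes the center of $G$, and $e$ the identity element. *)

theory Defs
  imports "HOL-Analysis.Analysis" "HOL-Algebra.Generated_Groups"
begin

text \<open>
  Smooth manifolds are modelled on a linear subspace \<open>V\<close> of a Euclidean space rather than on a
  whole type of class \<open>euclidean_space\<close>: such a type has dimension at least one, while
  \<open>V = {0}\<close> also gives the manifolds of dimension 0.  The dimension is \<open>dim V\<close>.

  In the next definition \<open>S\<close> is meant to be open relative to \<open>V\<close>.  The derivative at a point of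
  \<open>S\<close> is then determined on \<open>V\<close>, which is why only directions \<open>v \<in> V\<close> are used.
\<close>

primrec Ck_on ::
  "nat \<Rightarrow> 'a::euclidean_space set \<Rightarrow> 'a set \<Rightarrow> ('a \<Rightarrow> 'b::euclidean_space) \<Rightarrow> bool" where
  "Ck_on 0 V S f \<longleftrightarrow> continuous_on S f"
| "Ck_on (Suc k) V S f \<longleftrightarrow>
     (\<exists>f'. (\<forall>x\<in>S. (f has_derivative f' x) (at x within S)) \<and>
           (\<forall>v\<in>V. Ck_on k V S (\<lambda>x. f' x v)))"

definition smooth_on ::
  "'a::euclidean_space set \<Rightarrow> 'a set \<Rightarrow> ('a \<Rightarrow> 'b::euclidean_space) \<Rightarrow> bool" where
  "smooth_on V S f \<longleftrightarrow> (\<forall>k. Ck_on k V S f)"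

type_synonym ('m, 'e) atlas = "('m set \<times> ('m \<Rightarrow> 'e)) set"

text \<open>The topology of a manifold \<open>M\<close> is the subspace topology \<open>top_of_set M\<close>.\<close>

locale smooth_manifold =
  fixes M :: "'m::topological_space set"
    and V :: "'e::euclidean_space set"
    and A :: "('m, 'e) atlas"
  assumes Hausdorff: "Hausdorff_space (top_of_set M)"
    and second_countable: "second_countable (top_of_set M)"
    and model_subspace: "subspace V"
    and chart_domain: "\<And>U \<phi>. (U, \<phi>) \<in> A \<Longrightarrow> openin (top_of_set M) U"
    and chart_image: "\<And>U \<phi>. (U, \<phi>) \<in> A \<Longrightarrow> openin (top_of_set V) (\<phi> ` U)"
    and chart_homeomorphism:
      "\<And>U \<phi>. (U, \<phi>) \<in> A \<Longrightarrow> homeomorphism U (\<phi> ` U) \<phi> (inv_into U \<phi>)"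
    and charts_cover: "(\<Union>(U, \<phi>)\<in>A. U) = M"
    and charts_compatible:
      "\<And>U \<phi> U' \<psi>. (U, \<phi>) \<in> A \<Longrightarrow> (U', \<psi>) \<in> A \<Longrightarrow>
         smooth_on V (\<phi> ` (U \<inter> U')) (\<psi> \<circ> inv_into U \<phi>)"

text \<open>
  Continuity is required separately: it makes \<open>\<phi> ` (U \<inter> f -` U')\<close> open relative to \<open>V\<close>.
\<close>

definition smooth_map ::
  "'m::topological_space set \<Rightarrow> 'a::euclidean_space set \<Rightarrow> ('m, 'a) atlas \<Rightarrow>
   'n::topological_space set \<Rightarrow> ('n, 'b::euclidean_space) atlas \<Rightarrow> ('m \<Rightarrow> 'n) \<Rightarrow> bool" where
  "smooth_map M V A N B f \<longleftrightarrow>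
     continuous_on M f \<and> f ` M \<subseteq> N \<and>
     (\<forall>(U, \<phi>)\<in>A. \<forall>(U', \<psi>)\<in>B.
        smooth_on V (\<phi> ` (U \<inter> f -` U')) (\<psi> \<circ> f \<circ> inv_into U \<phi>))"

definition prod_atlas :: "('m, 'a) atlas \<Rightarrow> ('n, 'b) atlas \<Rightarrow> ('m \<times> 'n, 'a \<times> 'b) atlas" where
  "prod_atlas A B = {(U \<times> U', map_prod \<phi> \<psi>) |U \<phi> U' \<psi>. (U, \<phi>) \<in> A \<and> (U', \<psi>) \<in> B}"

locale lie_group = group G + smooth_manifold "carrier G" V A
  for G :: "('g::topological_space, 'r) monoid_scheme" (structure)
    and V :: "'e::euclidean_space set"
    and A :: "('g, 'e) atlas" +
  assumes smooth_mult:
      "smooth_map (carrier G \<times> carrier G) (V \<times> V) (prod_atlas A A) (carrier G) A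
         (\<lambda>(x, y). x \<otimes> y)"
    and smooth_inv: "smooth_map (carrier G) V A (carrier G) A (\<lambda>x. inv x)"

primrec lower_central_series :: "('g, 'r) monoid_scheme \<Rightarrow> nat \<Rightarrow> 'g set" where
  "lower_central_series G 0 = carrier G"
| "lower_central_series G (Suc n) =
     generate G (\<Union>x\<in>carrier G. \<Union>y\<in>lower_central_series G n.
       {x \<otimes>\<^bsub>G\<^esub> y \<otimes>\<^bsub>G\<^esub> inv\<^bsub>G\<^esub> x \<otimes>\<^bsub>G\<^esub> inv\<^bsub>G\<^esub> y})"

definition nilpotent_group :: "('g, 'r) monoid_scheme \<Rightarrow> bool" where
  "nilpotent_group G \<longleftrightarrow> (\<exists>n. lower_central_series G n = {\<one>\<^bsub>G\<^esub>})"

definition real_element :: "('g, 'r) monoid_scheme \<Rightarrow> 'g \<Rightarrow> bool" where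
  "real_element G g \<longleftrightarrow>
     g \<in> carrier G \<and> (\<exists>h\<in>carrier G. h \<otimes>\<^bsub>G\<^esub> g \<otimes>\<^bsub>G\<^esub> inv\<^bsub>G\<^esub> h = inv\<^bsub>G\<^esub> g)"

definition two_torsion :: "('g, 'r) monoid_scheme \<Rightarrow> 'g set" where
  "two_torsion G = {g \<in> carrier G. g [^]\<^bsub>G\<^esub> (2::nat) = \<one>\<^bsub>G\<^esub>}"

definition group_center :: "('g, 'r) monoid_scheme \<Rightarrow> 'g set" where
  "group_center G = {z \<in> carrier G. \<forall>x\<in>carrier G. z \<otimes>\<^bsub>G\<^esub> x = x \<otimes>\<^bsub>G\<^esub> z}"

end

theory Submission
  imports Defs
begin

text \<open>
  Write \<open>\<Gamma>\<^sub>0 = G, \<Gamma>\<^sub>1, \<dots>, \<Gamma>\<^sub>n = 1\<close> for the lower central series.  If \<open>h g h\<inverse> = g\<inverse>\<close>, then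
  \<open>g\<^sup>-\<^sup>2 = [h, g]\<close> lies in \<open>\<Gamma>\<^sub>1\<close>.  Since \<open>h\<close> also inverts \<open>g\<^sup>2\<close>, the same step puts \<open>g\<^sup>4\<close> into \<open>\<Gamma>\<^sub>2\<close>, and
  so on: \<open>g\<close> has 2-power order (\<open>inverted_power_in_lower_central_series\<close>).

  Such an element is central (\<open>two_power_torsion_central\<close>).  Suppose \<open>g\<close> commutes with \<open>\<Gamma>\<^sub>k\<^sub>+\<^sub>1\<close>.  For
  \<open>x \<in> \<Gamma>\<^sub>k\<close> the commutator \<open>c = [x, g]\<close> commutes with \<open>g\<close>, and \<open>c g\<close> is a conjugate of \<open>g\<close>, so \<open>c\<close> is
  killed by the same power of 2 as \<open>g\<close>.  In a Lie group there are no involutions close to \<open>1\<close>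
  (\<open>involutions_isolated\<close>), hence no nontrivial elements killed by a fixed power of 2 either; so \<open>c = 1\<close> for \<open>x\<close> close to
  \<open>1\<close>, and \<open>g\<close> commutes with an open subgroup of the connected group \<open>\<Gamma>\<^sub>k\<close>, that is with all of it.
  A central real element satisfies \<open>g = g\<inverse>\<close>.

  For simply connected \<open>G\<close> the point is that the squaring map is a covering with group
  \<open>G[2] = {g. g\<^sup>2 = 1}\<close>.  If \<open>x\<^sup>2 = y\<^sup>2\<close>, then \<open>y\<inverse> x\<close> is inverted by \<open>y\<close>, hence real, hence in \<open>G[2]\<close>
  (\<open>equal_squares\<close>).  As \<open>G[2]\<close> is discrete, squaring is locally injective, so it is open by
  invariance of domain (\<open>locally_injective_imp_open\<close>) and has continuous local inverses.  It is
  surjective because each quotient \<open>\<Gamma>\<^sub>k / \<Gamma>\<^sub>k\<^sub>+\<^sub>1\<close> is 2-divisible (\<open>square_root_exists\<close>).  Homotopies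
  therefore lift through it (\<open>has_square_root_unit_square\<close>).  If \<open>p\<close> is a path from \<open>1\<close> to
  \<open>g \<in> G[2]\<close>, then \<open>p\<^sup>2\<close> is a loop; it is null-homotopic, so its lift \<open>p\<close> is closed as well and \<open>g = 1\<close>
  (\<open>simply_connected_two_torsion_trivial\<close>).  Without nilpotency this fails: the group of unit
  quaternions is simply connected and contains \<open>-1\<close>.
\<close>

section \<open>Commutators and the lower central series\<close>

context group
begin

declare lower_central_series.simps(2) [simp del]

lemma cancel_inv_left:
  assumes "x \<in> carrier G" "y \<in> carrier G"
  shows "x \<otimes> (inv x \<otimes> y) = y" "inv x \<otimes> (x \<otimes> y) = y"
  using assms by (simp_all flip: m_assoc)

lemmas word_simps = m_assoc inv_mult_group cancel_inv_left

lemma conj_nat_pow: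
  assumes "h \<in> carrier G" "g \<in> carrier G"
  shows "(h \<otimes> g \<otimes> inv h) [^] (n::nat) = h \<otimes> g [^] n \<otimes> inv h"
  using assms by (induction n) (simp_all add: word_simps)

lemma lower_central_series_normal: "lower_central_series G n \<lhd> G"
proof (induction n)
  case 0
  show ?case by (simp add: normal_inv_iff subgroup_self)
next
  case (Suc n)
  let ?L = "lower_central_series G n"
  have L: "?L \<subseteq> carrier G"
    using Suc by (simp add: normal_imp_subgroup subgroup.subset)
  have conj: "g \<otimes> h \<otimes> inv g \<in> ?L" if "g \<in> carrier G" "h \<in> ?L" for g h
    using Suc that by (simp add: normal_inv_iff)
  show ?case
    unfolding lower_central_series.simps
  proof (rule normal_generateI)
    show "(\<Union>x\<in>carrier G. \<Union>y\<in>?L. {x \<otimes> y \<otimes> inv x \<otimes> inv y}) \<subseteq> carrier G"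
      using L by auto
  next
    fix h g
    assume "h \<in> (\<Union>x\<in>carrier G. \<Union>y\<in>?L. {x \<otimes> y \<otimes> inv x \<otimes> inv y})" and g: "g \<in> carrier G"
    then obtain x y where xy: "x \<in> carrier G" "y \<in> ?L" "h = x \<otimes> y \<otimes> inv x \<otimes> inv y"
      by auto
    then have y: "y \<in> carrier G" using L by auto
    let ?x = "g \<otimes> x \<otimes> inv g" and ?y = "g \<otimes> y \<otimes> inv g"
    have "g \<otimes> h \<otimes> inv g = ?x \<otimes> ?y \<otimes> inv ?x \<otimes> inv ?y"
      using xy y g by (simp add: word_simps)
    moreover have "?x \<in> carrier G" "?y \<in> ?L"
      using xy y g conj by auto
    ultimately show "g \<otimes> h \<otimes> inv g \<in> (\<Union>x\<in>carrier G. \<Union>y\<in>?L. {x \<otimes> y \<otimes> inv x \<otimes> inv y})"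
      by blast
  qed
qed

lemma lower_central_series_subgroup: "subgroup (lower_central_series G n) G"
  by (simp add: lower_central_series_normal normal_imp_subgroup)

lemma lower_central_series_carrier: "x \<in> lower_central_series G n \<Longrightarrow> x \<in> carrier G"
  by (meson lower_central_series_subgroup subgroup.mem_carrier)

lemma lower_central_series_closed:
  shows "\<lbrakk>x \<in> lower_central_series G n; y \<in> lower_central_series G n\<rbrakk> \<Longrightarrow>
      x \<otimes> y \<in> lower_central_series G n"
    and "x \<in> lower_central_series G n \<Longrightarrow> inv x \<in> lower_central_series G n"
    and "\<lbrakk>g \<in> carrier G; x \<in> lower_central_series G n\<rbrakk> \<Longrightarrow>
      g \<otimes> x \<otimes> inv g \<in> lower_central_series G n"
    and "\<lbrakk>g \<in> carrier G; x \<in> lower_central_series G n\<rbrakk> \<Longrightarrow>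
      inv g \<otimes> x \<otimes> g \<in> lower_central_series G n"
  using lower_central_series_subgroup[of n] lower_central_series_normal[of n]
  by (simp_all add: subgroup.m_closed subgroup.m_inv_closed normal_inv_iff
      normal.inv_op_closed1)

lemma commutator_in_lower_central_series:
  assumes "x \<in> carrier G" "y \<in> lower_central_series G n"
  shows "x \<otimes> y \<otimes> inv x \<otimes> inv y \<in> lower_central_series G (Suc n)"
    and "y \<otimes> x \<otimes> inv y \<otimes> inv x \<in> lower_central_series G (Suc n)"
proof -
  show *: "x \<otimes> y \<otimes> inv x \<otimes> inv y \<in> lower_central_series G (Suc n)"
    using assms by (auto simp: lower_central_series.simps(2) intro!: generate.incl)
  have "y \<otimes> x \<otimes> inv y \<otimes> inv x = inv (x \<otimes> y \<otimes> inv x \<otimes> inv y)"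
    using assms lower_central_series_carrier by (simp add: word_simps)
  then show "y \<otimes> x \<otimes> inv y \<otimes> inv x \<in> lower_central_series G (Suc n)"
    using * lower_central_series_closed(2) by metis
qed

text \<open>
  Conjugation by \<open>h\<close> inverts every power of \<open>g\<close>, so \<open>h x h\<inverse> x\<inverse> = x\<^sup>-\<^sup>2\<close> for each of these powers
  \<open>x\<close>: squaring pushes \<open>x\<close> one step down the lower central series.
\<close>

lemma inverted_power_in_lower_central_series:
  assumes h: "h \<in> carrier G" and g: "g \<in> carrier G" and hg: "h \<otimes> g \<otimes> inv h = inv g"
  shows "g [^] (2 ^ k :: nat) \<in> lower_central_series G k"
proof (induction k)
  case 0
  then show ?case using g by simp
next
  case (Suc k)
  let ?x = "g [^] (2 ^ k :: nat)"
  have "h \<otimes> ?x \<otimes> inv h = inv ?x"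
    using conj_nat_pow[OF h g, of "2 ^ k"] hg g by (simp add: nat_pow_inv)
  then have "h \<otimes> ?x \<otimes> inv h \<otimes> inv ?x = inv (?x \<otimes> ?x)"
    using g by (simp add: inv_mult_group)
  then have "inv (?x \<otimes> ?x) \<in> lower_central_series G (Suc k)"
    using commutator_in_lower_central_series(1)[OF h Suc] by simp
  then have "?x \<otimes> ?x \<in> lower_central_series G (Suc k)"
    using lower_central_series_closed(2)[of "inv (?x \<otimes> ?x)"] g by simp
  also have "?x \<otimes> ?x = g [^] (2 ^ Suc k :: nat)"
    using g by (simp add: nat_pow_mult mult_2)
  finally show ?case .
qed

section \<open>Square roots modulo the lower central series\<close>

text \<open>
  The preimage in \<open>\<Gamma>\<^sub>k\<close> of the subgroup of squares of the abelian group \<open>\<Gamma>\<^sub>k / \<Gamma>\<^sub>k\<^sub>+\<^sub>1\<close>.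
\<close>

definition square_cosets :: "nat \<Rightarrow> 'a set" where
  "square_cosets k =
     {d \<otimes> d \<otimes> m |d m. d \<in> lower_central_series G k \<and> m \<in> lower_central_series G (Suc k)}"

lemma square_cosets_subgroup: "subgroup (square_cosets k) G"
proof (rule subgroupI)
  let ?L = "lower_central_series G k" and ?M = "lower_central_series G (Suc k)"
  note carr = lower_central_series_carrier
  note closed = lower_central_series_closed
  show "square_cosets k \<subseteq> carrier G"
    unfolding square_cosets_def by (auto dest!: carr)
  have "\<one> \<otimes> \<one> \<otimes> \<one> \<in> square_cosets k"
    unfolding square_cosets_def
    using subgroup.one_closed[OF lower_central_series_subgroup] by blast
  then show "square_cosets k \<noteq> {}" by blast
  fix a
  assume "a \<in> square_cosets k"
  then obtain d m where d: "d \<in> ?L" and m: "m \<in> ?M" and a: "a = d \<otimes> d \<otimes> m"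
    unfolding square_cosets_def by blast
  note c = carr[OF d] carr[OF m]
  have "inv a = inv d \<otimes> inv d \<otimes> ((d \<otimes> d) \<otimes> inv m \<otimes> inv (d \<otimes> d))"
    using c a by (simp add: word_simps)
  moreover have "(d \<otimes> d) \<otimes> inv m \<otimes> inv (d \<otimes> d) \<in> ?M"
    using c m by (simp add: closed)
  ultimately show "inv a \<in> square_cosets k"
    unfolding square_cosets_def using closed(2)[OF d] by blast
  fix b
  assume "b \<in> square_cosets k"
  then obtain e n where e: "e \<in> ?L" and n: "n \<in> ?M" and b: "b = e \<otimes> e \<otimes> n"
    unfolding square_cosets_def by blast
  note c = c carr[OF e] carr[OF n]
  have "a \<otimes> b = (d \<otimes> e) \<otimes> (d \<otimes> e) \<otimes>
      ((inv e \<otimes> (inv d \<otimes> inv e \<otimes> inv (inv d) \<otimes> inv (inv e)) \<otimes> e) \<otimes>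
       (inv (e \<otimes> e) \<otimes> m \<otimes> (e \<otimes> e)) \<otimes> n)"
    using c a b by (simp add: word_simps)
  moreover have "inv d \<otimes> inv e \<otimes> inv (inv d) \<otimes> inv (inv e) \<in> ?M"
    using c closed(2)[OF e] by (intro commutator_in_lower_central_series) auto
  then have "(inv e \<otimes> (inv d \<otimes> inv e \<otimes> inv (inv d) \<otimes> inv (inv e)) \<otimes> e) \<otimes>
       (inv (e \<otimes> e) \<otimes> m \<otimes> (e \<otimes> e)) \<otimes> n \<in> ?M"
    using c m n by (simp add: closed)
  ultimately show "a \<otimes> b \<in> square_cosets k"
    unfolding square_cosets_def using closed(1)[OF d e] by blast
qed

text \<open>
  Modulo \<open>\<Gamma>\<^sub>k\<^sub>+\<^sub>2\<close> the commutator \<open>[x, y]\<close> with \<open>y \<in> \<Gamma>\<^sub>k\<close> depends only on \<open>y\<close> modulo \<open>\<Gamma>\<^sub>k\<^sub>+\<^sub>1\<close> and is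
  additive in \<open>y\<close>; hence \<open>[x, d\<^sup>2 m]\<close> is the square \<open>[x, d]\<^sup>2\<close> up to \<open>\<Gamma>\<^sub>k\<^sub>+\<^sub>2\<close>.
\<close>

lemma square_cosets_Suc:
  assumes "lower_central_series G k \<subseteq> square_cosets k"
  shows "lower_central_series G (Suc k) \<subseteq> square_cosets (Suc k)"
proof -
  let ?L = "lower_central_series G k" and ?M = "lower_central_series G (Suc k)"
    and ?N = "lower_central_series G (Suc (Suc k))"
  note carr = lower_central_series_carrier
  note closed = lower_central_series_closed
  have "x \<otimes> y \<otimes> inv x \<otimes> inv y \<in> square_cosets (Suc k)"
    if x: "x \<in> carrier G" and y: "y \<in> ?L" for x y
  proof -
    obtain d m where d: "d \<in> ?L" and m: "m \<in> ?M" and ydm: "y = d \<otimes> d \<otimes> m"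
      using assms y unfolding square_cosets_def by blast
    define a where "a = x \<otimes> d \<otimes> inv x \<otimes> inv d"
    define n where "n = x \<otimes> m \<otimes> inv x \<otimes> inv m"
    have a: "a \<in> ?M" and n: "n \<in> ?N"
      unfolding a_def n_def using x d m commutator_in_lower_central_series by blast+
    note c = x carr[OF d] carr[OF m]
    note ca = carr[OF a] carr[OF n]
    have "x \<otimes> y \<otimes> inv x \<otimes> inv y =
        (x \<otimes> d \<otimes> inv x \<otimes> inv d) \<otimes> d \<otimes> (x \<otimes> d \<otimes> inv x \<otimes> inv d) \<otimes> d \<otimes>
        (x \<otimes> m \<otimes> inv x \<otimes> inv m) \<otimes> inv d \<otimes> inv d"
      unfolding ydm using c by (simp add: word_simps)
    also have "\<dots> = a \<otimes> d \<otimes> a \<otimes> d \<otimes> n \<otimes> inv d \<otimes> inv d"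
      unfolding a_def n_def ..
    also have "\<dots> = a \<otimes> a \<otimes> ((inv a \<otimes> d \<otimes> inv (inv a) \<otimes> inv d) \<otimes>
        ((d \<otimes> d) \<otimes> n \<otimes> inv (d \<otimes> d)))"
      using c ca by (simp add: word_simps)
    finally have eq: "x \<otimes> y \<otimes> inv x \<otimes> inv y = \<dots>" .
    have "inv a \<otimes> d \<otimes> inv (inv a) \<otimes> inv d \<in> ?N"
      using c closed(2)[OF a] by (intro commutator_in_lower_central_series) auto
    then have "(inv a \<otimes> d \<otimes> inv (inv a) \<otimes> inv d) \<otimes> ((d \<otimes> d) \<otimes> n \<otimes> inv (d \<otimes> d)) \<in> ?N"
      using c n by (simp add: closed)
    then show ?thesis
      unfolding square_cosets_def eq using a by blast
  qed
  then show ?thesis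
    unfolding lower_central_series.simps(2)[of G k]
    by (intro generate_subgroup_incl square_cosets_subgroup) auto
qed

text \<open>
  If every \<open>\<Gamma>\<^sub>k / \<Gamma>\<^sub>k\<^sub>+\<^sub>1\<close> is 2-divisible, a root of \<open>y\<close> modulo \<open>\<Gamma>\<^sub>k\<close> can be corrected to a root modulo
  \<open>\<Gamma>\<^sub>k\<^sub>+\<^sub>1\<close>: if \<open>y = x\<^sup>2 m\<close> and \<open>d\<^sup>2\<close> agrees with \<open>m\<close> up to \<open>\<Gamma>\<^sub>k\<^sub>+\<^sub>1\<close>, replace \<open>x\<close> by \<open>x d\<close>.
\<close>

lemma square_root_exists:
  assumes base: "carrier G \<subseteq> square_cosets 0"
    and n: "lower_central_series G n = {\<one>}"
    and y: "y \<in> carrier G"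
  shows "\<exists>x\<in>carrier G. x \<otimes> x = y"
proof -
  note carr = lower_central_series_carrier
  note closed = lower_central_series_closed
  have sq: "lower_central_series G k \<subseteq> square_cosets k" for k
    using base square_cosets_Suc by (induction k) auto
  have "\<exists>x\<in>carrier G. \<exists>m\<in>lower_central_series G k. y = x \<otimes> x \<otimes> m" for k
  proof (induction k)
    case 0
    show ?case using y by (intro bexI[of _ "\<one>"] bexI[of _ y]) auto
  next
    case (Suc k)
    then obtain x m where x: "x \<in> carrier G" and m: "m \<in> lower_central_series G k"
      and ym: "y = x \<otimes> x \<otimes> m" by blast
    obtain d m' where d: "d \<in> lower_central_series G k"
      and m': "m' \<in> lower_central_series G (Suc k)" and mm: "m = d \<otimes> d \<otimes> m'"
      using sq m unfolding square_cosets_def by blast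
    note c = x carr[OF d] carr[OF m']
    have "y = (x \<otimes> d) \<otimes> (x \<otimes> d) \<otimes>
        ((inv d \<otimes> (inv x \<otimes> inv d \<otimes> inv (inv x) \<otimes> inv (inv d)) \<otimes> d) \<otimes> m')"
      unfolding ym mm using c by (simp add: word_simps)
    moreover have "inv x \<otimes> inv d \<otimes> inv (inv x) \<otimes> inv (inv d) \<in> lower_central_series G (Suc k)"
      using c closed(2)[OF d] by (intro commutator_in_lower_central_series) auto
    then have "(inv d \<otimes> (inv x \<otimes> inv d \<otimes> inv (inv x) \<otimes> inv (inv d)) \<otimes> d) \<otimes> m' \<in>
        lower_central_series G (Suc k)"
      using c m' by (simp add: closed)
    moreover have "x \<otimes> d \<in> carrier G" using c by simp
    ultimately show ?case by blast
  qed
  from this[of n] n show ?thesis by auto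
qed

end

section \<open>Topological groups\<close>

locale topological_group = group G
  for G :: "('g::topological_space, 'r) monoid_scheme" (structure) +
  assumes mult_continuous: "continuous_on (carrier G \<times> carrier G) (\<lambda>(x, y). x \<otimes> y)"
    and inv_continuous: "continuous_on (carrier G) (\<lambda>x. inv x)"
begin

lemma continuous_on_group_mult:
  assumes "continuous_on S f" "continuous_on S g"
    and "f \<in> S \<rightarrow> carrier G" "g \<in> S \<rightarrow> carrier G"
  shows "continuous_on S (\<lambda>x. f x \<otimes> g x)"
proof -
  have "continuous_on S (\<lambda>x. (\<lambda>(x, y). x \<otimes> y) (f x, g x))"
    using assms by (intro continuous_on_compose2[OF mult_continuous]) (auto intro!: continuous_intros)
  then show ?thesis by simp
qed

lemma continuous_on_group_inv:
  assumes "continuous_on S f" "f \<in> S \<rightarrow> carrier G"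
  shows "continuous_on S (\<lambda>x. inv (f x))"
  using assms by (intro continuous_on_compose2[OF inv_continuous]) auto

lemma openin_group_preimage:
  assumes "continuous_on S f" "f \<in> S \<rightarrow> carrier G" "openin (top_of_set (carrier G)) U"
  shows "openin (top_of_set S) {x \<in> S. f x \<in> U}"
  using continuous_openin_preimage[OF assms] by (simp add: vimage_def Collect_conj_eq)

text \<open>
  An open subgroup of a connected group is everything.  The neighbourhood \<open>W\<close> makes \<open>C \<inter> H\<close> open in
  \<open>H\<close>, and its cosets are open too.
\<close>

lemma connected_subgroup_subset:
  assumes H: "connected H" "subgroup H G" and C: "subgroup C G"
    and W: "openin (top_of_set H) W" "\<one> \<in> W" "W \<subseteq> C"
  shows "H \<subseteq> C"
proof
  fix b
  assume b: "b \<in> H"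
  have Hc: "x \<in> carrier G" if "x \<in> H" for x
    using that H(2) by (rule subgroup.mem_carrier[rotated])
  note Hcl = subgroup.m_closed[OF H(2)] subgroup.m_inv_closed[OF H(2)]
  note Ccl = subgroup.m_closed[OF C] subgroup.m_inv_closed[OF C]
  show "b \<in> C"
  proof (rule connected_induction_simple[OF H(1) _ b])
    show "\<one> \<in> H" "\<one> \<in> C"
      using H(2) C by (simp_all add: subgroup.one_closed)
    fix a
    assume a: "a \<in> H"
    let ?T = "{x \<in> H. inv a \<otimes> x \<in> W}"
    have "continuous_on H (\<lambda>x. inv a \<otimes> x)"
      using a Hc by (intro continuous_on_group_mult continuous_intros) auto
    moreover have "(\<lambda>x. inv a \<otimes> x) \<in> H \<rightarrow> H"
      using a Hcl by auto
    ultimately have "openin (top_of_set H) ?T"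
      using continuous_openin_preimage[OF _ _ W(1)] by (simp add: vimage_def Collect_conj_eq)
    moreover have "a \<in> ?T" using a Hc W(2) by simp
    moreover have "y \<in> C" if x: "x \<in> ?T" "x \<in> C" and y: "y \<in> ?T" for x y
    proof -
      have "inv a \<otimes> x \<in> C" "inv a \<otimes> y \<in> C" using x y W(3) by auto
      then have "x \<otimes> inv (inv a \<otimes> x) \<otimes> (inv a \<otimes> y) \<in> C"
        using x(2) by (blast intro: Ccl)
      moreover have "x \<otimes> inv (inv a \<otimes> x) \<otimes> (inv a \<otimes> y) = y"
        using a x y Hc by (simp add: word_simps)
      ultimately show ?thesis by simp
    qed
    ultimately show "\<exists>T. openin (top_of_set H) T \<and> a \<in> T \<and> (\<forall>x\<in>T. \<forall>y\<in>T. x \<in> C \<longrightarrow> y \<in> C)"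
      by blast
  qed
qed

text \<open>
  A product of generators can be pulled back to \<open>\<one>\<close> one factor at a time, each time inside a
  translate of the connected set of generators.
\<close>

lemma connected_generate:
  assumes S: "connected S" "S \<subseteq> carrier G" "\<one> \<in> S"
  shows "connected (generate G S)"
proof -
  let ?H = "generate G S"
  have Hc: "x \<in> carrier G" if "x \<in> ?H" for x
    using that generate_in_carrier[OF S(2)] by blast
  have "\<exists>C. connected C \<and> C \<subseteq> ?H \<and> \<one> \<in> C \<and> h \<in> C" if "h \<in> ?H" for h
    using that
  proof (induction rule: generate.induct)
    case one
    show ?case by (intro exI[of _ "{\<one>}"]) (auto intro: generate.one)
  next
    case (incl h)
    then show ?case using S by (intro exI[of _ S]) (auto intro: generate.incl)
  next
    case (inv h)
    have "connected ((\<lambda>x. inv x) ` S)"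
      using S by (intro connected_continuous_image continuous_on_subset[OF inv_continuous])
    moreover have "\<one> \<in> (\<lambda>x. inv x) ` S"
      using S(3) by (rule rev_image_eqI) simp
    ultimately show ?case
      using inv by (intro exI[of _ "(\<lambda>x. inv x) ` S"]) (auto intro: generate.inv)
  next
    case (eng h1 h2)
    then obtain C D where C: "connected C" "C \<subseteq> ?H" "\<one> \<in> C" "h1 \<in> C"
      and D: "connected D" "D \<subseteq> ?H" "\<one> \<in> D" "h2 \<in> D" by blast
    let ?D = "(\<lambda>x. h1 \<otimes> x) ` D"
    have "continuous_on D (\<lambda>x. h1 \<otimes> x)"
      using C(2,4) D(2) Hc by (intro continuous_on_group_mult continuous_intros) auto
    then have "connected ?D" using D(1) by (rule connected_continuous_image)
    moreover have "h1 \<in> ?D"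
      using D(3) C(2,4) Hc by (intro image_eqI[of _ _ \<one>]) auto
    ultimately have "connected (C \<union> ?D)"
      using C by (intro connected_Un) auto
    moreover have "?D \<subseteq> ?H"
      using C(2,4) D(2) by (auto intro: generate.eng)
    ultimately show ?case
      using C D by (intro exI[of _ "C \<union> ?D"]) auto
  qed
  then have "\<forall>h\<in>?H. connected_component ?H \<one> h"
    unfolding connected_component_def by blast
  then show ?thesis
    unfolding connected_iff_connected_component
    by (meson connected_component_sym connected_component_trans)
qed

lemma connected_lower_central_series:
  assumes "connected (carrier G)"
  shows "connected (lower_central_series G n)"
proof (induction n)
  case 0
  show ?case using assms by simp
next
  case (Suc n)
  let ?L = "lower_central_series G n"
  let ?f = "\<lambda>(x, y). x \<otimes> y \<otimes> inv x \<otimes> inv y"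
  have L: "?L \<subseteq> carrier G" using lower_central_series_carrier by blast
  have "continuous_on (carrier G \<times> ?L) (\<lambda>p. fst p \<otimes> snd p \<otimes> inv (fst p) \<otimes> inv (snd p))"
    using L by (intro continuous_on_group_mult continuous_on_group_inv continuous_intros) auto
  then have "connected (?f ` (carrier G \<times> ?L))"
    using Suc assms by (intro connected_continuous_image connected_Times) (auto simp: case_prod_beta)
  moreover have "?f ` (carrier G \<times> ?L) =
      (\<Union>x\<in>carrier G. \<Union>y\<in>?L. {x \<otimes> y \<otimes> inv x \<otimes> inv y})" by auto
  moreover have "\<one> \<in> ?f ` (carrier G \<times> ?L)"
    using subgroup.one_closed[OF lower_central_series_subgroup[of n]]
    by (intro image_eqI[of _ _ "(\<one>, \<one>)"]) auto
  ultimately show ?case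
    unfolding lower_central_series.simps(2) using L by (intro connected_generate) auto
qed

end

section \<open>Real elements and torsion\<close>

text \<open>
  Involutions bounded away from \<open>\<one>\<close> are the form in which smoothness enters the description of
  the real elements; a general connected nilpotent topological group, such as an infinite power of
  the circle group, may contain arbitrarily small involutions.
\<close>

locale connected_nilpotent_group = topological_group G
  for G :: "('g::topological_space, 'r) monoid_scheme" (structure) +
  assumes connected_carrier: "connected (carrier G)"
    and nilpotent: "nilpotent_group G"
    and involutions_isolated:
      "\<exists>U. openin (top_of_set (carrier G)) U \<and> \<one> \<in> U \<and> (\<forall>x\<in>U. x \<otimes> x = \<one> \<longrightarrow> x = \<one>)"
begin

text \<open>
  Repeated squaring of \<open>x\<close> reaches an involution just before it reaches \<open>\<one>\<close>, and that involution is
  still close to \<open>\<one>\<close> when \<open>x\<close> is close enough.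
\<close>

lemma two_power_torsion_isolated:
  "\<exists>U. openin (top_of_set (carrier G)) U \<and> \<one> \<in> U \<and>
     (\<forall>x\<in>U. x [^] (2 ^ n :: nat) = \<one> \<longrightarrow> x = \<one>)"
proof (induction n)
  case 0
  show ?case
    by (intro exI[of _ "carrier G"]) auto
next
  case (Suc n)
  then obtain U where U: "openin (top_of_set (carrier G)) U" "\<one> \<in> U"
    "\<And>x. x \<in> U \<Longrightarrow> x [^] (2 ^ n :: nat) = \<one> \<Longrightarrow> x = \<one>" by blast
  obtain V where V: "openin (top_of_set (carrier G)) V" "\<one> \<in> V"
    "\<And>x. x \<in> V \<Longrightarrow> x \<otimes> x = \<one> \<Longrightarrow> x = \<one>"
    using involutions_isolated by blast
  let ?W = "V \<inter> {x \<in> carrier G. x \<otimes> x \<in> U}"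
  have "continuous_on (carrier G) (\<lambda>x. x \<otimes> x)"
    by (intro continuous_on_group_mult continuous_intros) auto
  then have "openin (top_of_set (carrier G)) ?W"
    using V(1) U(1) by (intro openin_Int openin_group_preimage) auto
  moreover have "\<one> \<in> ?W" using U V by simp
  moreover have "x = \<one>" if x: "x \<in> ?W" "x [^] (2 ^ Suc n :: nat) = \<one>" for x
  proof -
    have "(x [^] (2::nat)) [^] (2 ^ n :: nat) = x [^] (2 ^ Suc n :: nat)"
      using x by (simp add: nat_pow_pow)
    moreover have "x [^] (2::nat) = x \<otimes> x"
      using x by (simp add: numeral_2_eq_2)
    ultimately have "x \<otimes> x = \<one>" using x U(3)[of "x \<otimes> x"] by simp
    then show ?thesis using x V(3) by blast
  qed
  ultimately show ?case by blast
qed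

text \<open>
  The commutator \<open>c = [x, g]\<close> lies in \<open>\<Gamma>\<^sub>k\<^sub>+\<^sub>1\<close>, so it commutes with \<open>g\<close> and \<open>c\<^sup>m = c\<^sup>m g\<^sup>m = (c g)\<^sup>m\<close>, a
  conjugate of \<open>g\<^sup>m = 1\<close> when \<open>m = 2\<^sup>n\<close>.  For \<open>x\<close> close to \<open>\<one>\<close> this gives \<open>c = 1\<close>, and connectedness of
  \<open>\<Gamma>\<^sub>k\<close> extends the conclusion to all \<open>x\<close>.
\<close>

lemma two_power_torsion_commutes_step:
  assumes g: "g \<in> carrier G" and tors: "g [^] (2 ^ n :: nat) = \<one>"
    and comm: "\<And>c. c \<in> lower_central_series G (Suc k) \<Longrightarrow> c \<otimes> g = g \<otimes> c"
    and x: "x \<in> lower_central_series G k"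
  shows "x \<otimes> g = g \<otimes> x"
proof -
  let ?L = "lower_central_series G k"
  have L: "?L \<subseteq> carrier G" using lower_central_series_carrier by blast
  obtain U where U: "openin (top_of_set (carrier G)) U" "\<one> \<in> U"
    "\<And>x. x \<in> U \<Longrightarrow> x [^] (2 ^ n :: nat) = \<one> \<Longrightarrow> x = \<one>"
    using two_power_torsion_isolated[of n] by blast
  let ?W = "{x \<in> ?L. x \<otimes> g \<otimes> inv x \<otimes> inv g \<in> U}"
  let ?C = "{x \<in> carrier G. x \<otimes> g = g \<otimes> x}"
  have "?L \<subseteq> ?C"
  proof (rule connected_subgroup_subset)
    show "connected ?L" using connected_carrier by (rule connected_lower_central_series)
    show "subgroup ?L G" by (rule lower_central_series_subgroup)
    show "subgroup ?C G"
    proof (rule subgroupI)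
      show "?C \<noteq> {}" using g by force
      fix a assume a: "a \<in> ?C"
      then have ag: "a \<in> carrier G" "a \<otimes> g = g \<otimes> a" by auto
      have "g \<otimes> inv a = inv a \<otimes> (a \<otimes> g) \<otimes> inv a" using ag(1) g by (simp add: word_simps)
      also have "\<dots> = inv a \<otimes> g" unfolding ag(2) using ag(1) g by (simp add: word_simps)
      finally have "g \<otimes> inv a = inv a \<otimes> g" .
      then show "inv a \<in> ?C" using a by simp
      fix b assume b: "b \<in> ?C"
      have "a \<otimes> b \<otimes> g = a \<otimes> (g \<otimes> b)" using a b g by (simp add: m_assoc)
      also have "\<dots> = g \<otimes> (a \<otimes> b)" using a b g by (simp flip: m_assoc)
      finally show "a \<otimes> b \<in> ?C" using a b by simp
    qed auto
    have "continuous_on ?L (\<lambda>x. x \<otimes> g \<otimes> inv x \<otimes> inv g)"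
      using L g by (intro continuous_on_group_mult continuous_on_group_inv continuous_intros) auto
    then show "openin (top_of_set ?L) ?W"
      using U(1) L g by (intro openin_group_preimage) auto
    show "\<one> \<in> ?W"
      using g U(2) subgroup.one_closed[OF lower_central_series_subgroup[of k]] by simp
    show "?W \<subseteq> ?C"
    proof
      fix x assume x: "x \<in> ?W"
      then have xc: "x \<in> carrier G" using L by auto
      define c where "c = x \<otimes> g \<otimes> inv x \<otimes> inv g"
      have c: "c \<in> lower_central_series G (Suc k)"
        unfolding c_def using x g by (intro commutator_in_lower_central_series(2)) auto
      then have cc: "c \<in> carrier G" by (rule lower_central_series_carrier)
      have cg: "c \<otimes> g = x \<otimes> g \<otimes> inv x"
        unfolding c_def using xc g by (simp add: word_simps)
      have "c [^] (2 ^ n :: nat) = c [^] (2 ^ n :: nat) \<otimes> g [^] (2 ^ n :: nat)"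
        using tors cc by simp
      also have "\<dots> = (c \<otimes> g) [^] (2 ^ n :: nat)"
        using pow_mult_distrib comm[OF c] cc g by simp
      also have "\<dots> = \<one>"
        unfolding cg using conj_nat_pow xc g tors by simp
      finally have "c = \<one>" using U(3) x unfolding c_def by blast
      then have "(x \<otimes> g \<otimes> inv x) \<otimes> x = g \<otimes> x" using cg g by simp
      then show "x \<in> ?C" using xc g by (simp add: word_simps)
    qed
  qed
  then show ?thesis using x by blast
qed

lemma two_power_torsion_central:
  assumes g: "g \<in> carrier G" and tors: "g [^] (2 ^ n :: nat) = \<one>"
  shows "g \<in> group_center G"
proof -
  obtain N where N: "lower_central_series G N = {\<one>}"
    using nilpotent unfolding nilpotent_group_def by blast
  have "\<forall>x\<in>lower_central_series G (N - j). x \<otimes> g = g \<otimes> x" for j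
  proof (induction j)
    case 0
    show ?case using N g by simp
  next
    case (Suc j)
    show ?case
    proof (cases "j < N")
      case True
      then have "Suc (N - Suc j) = N - j" by simp
      with Suc show ?thesis
        using two_power_torsion_commutes_step[OF g tors, of "N - Suc j"] by metis
    next
      case False
      with Suc show ?thesis by simp
    qed
  qed
  from this[of N] show ?thesis
    using g unfolding group_center_def by simp
qed

lemma square_eq_pow: "x \<in> carrier G \<Longrightarrow> x [^] (2::nat) = x \<otimes> x"
  by (simp add: numeral_2_eq_2)

lemma real_element_iff:
  assumes g: "g \<in> carrier G"
  shows "real_element G g \<longleftrightarrow> g [^] (2::nat) = \<one>"
proof
  assume "real_element G g"
  then obtain h where h: "h \<in> carrier G" "h \<otimes> g \<otimes> inv h = inv g"
    unfolding real_element_def by blast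
  obtain N where "lower_central_series G N = {\<one>}"
    using nilpotent unfolding nilpotent_group_def by blast
  then have "g [^] (2 ^ N :: nat) = \<one>"
    using inverted_power_in_lower_central_series[OF h(1) g h(2), of N] by simp
  then have "g \<in> group_center G" by (rule two_power_torsion_central[OF g])
  then have "g \<otimes> h = h \<otimes> g"
    using h(1) unfolding group_center_def by blast
  then have "h \<otimes> g \<otimes> inv h = g"
    using g h(1) by (metis inv_solve_right m_closed)
  then show "g [^] (2::nat) = \<one>"
    using h(2) g by (simp add: square_eq_pow) (metis r_inv)
next
  assume "g [^] (2::nat) = \<one>"
  then have "inv g = g" using g by (simp add: square_eq_pow inv_equality)
  then show "real_element G g"
    unfolding real_element_def using g by (auto intro!: bexI[of _ \<one>])
qed

lemma two_torsion_iff: "x \<in> two_torsion G \<longleftrightarrow> x \<in> carrier G \<and> x \<otimes> x = \<one>"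
  unfolding two_torsion_def by (auto simp: square_eq_pow)

lemma real_elements_eq_two_torsion: "{g. real_element G g} = two_torsion G"
proof -
  have "real_element G g \<Longrightarrow> g \<in> carrier G" for g
    by (simp add: real_element_def)
  then show ?thesis
    using real_element_iff by (auto simp: two_torsion_def)
qed

lemma two_torsion_central: "two_torsion G \<subseteq> group_center G"
proof
  fix g assume "g \<in> two_torsion G"
  then show "g \<in> group_center G"
    using two_power_torsion_central[of g 1] by (simp add: two_torsion_def)
qed

section \<open>The squaring map\<close>

text \<open>
  If \<open>x\<^sup>2 = y\<^sup>2\<close> then \<open>a = y\<inverse> x\<close> satisfies \<open>a y a = y\<close>, that is \<open>y\<inverse> a y = a\<inverse>\<close>: it is real, hence an
  involution or trivial.
\<close>

lemma equal_squares:
  assumes x: "x \<in> carrier G" and y: "y \<in> carrier G" and eq: "x \<otimes> x = y \<otimes> y"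
  shows "inv y \<otimes> x \<in> two_torsion G"
proof -
  let ?a = "inv y \<otimes> x"
  have "inv y \<otimes> ?a \<otimes> inv (inv y) = inv y \<otimes> inv y \<otimes> (x \<otimes> x) \<otimes> inv x \<otimes> y"
    using x y by (simp add: word_simps)
  also have "\<dots> = inv ?a"
    unfolding eq using x y by (simp add: word_simps)
  finally have "real_element G ?a"
    unfolding real_element_def using x y by (intro conjI bexI[of _ "inv y"]) auto
  then show ?thesis using real_elements_eq_two_torsion by blast
qed

text \<open>
  \<open>G[2]\<close> is discrete: two of its elements differ by an involution or by \<open>\<one>\<close>, and involutions stay
  away from \<open>\<one>\<close>.
\<close>

lemma two_torsion_valued_constant:
  assumes T: "connected T" and k: "continuous_on T k" "k \<in> T \<rightarrow> two_torsion G"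
    and st: "s \<in> T" "t \<in> T"
  shows "k s = k t"
proof -
  have kc: "k x \<in> carrier G" "k x \<otimes> k x = \<one>" if "x \<in> T" for x
    using k(2) that two_torsion_iff by blast+
  obtain U where U: "openin (top_of_set (carrier G)) U" "\<one> \<in> U"
    "\<And>x. x \<in> U \<Longrightarrow> x \<otimes> x = \<one> \<Longrightarrow> x = \<one>"
    using involutions_isolated by blast
  show ?thesis
  proof (rule connected_induction_simple[OF T st, where P = "\<lambda>x. k s = k x"])
    fix a assume a: "a \<in> T"
    let ?O = "{x \<in> T. inv (k a) \<otimes> k x \<in> U}"
    have "continuous_on T (\<lambda>x. inv (k a) \<otimes> k x)"
      using k(1) kc a by (intro continuous_on_group_mult continuous_intros) auto
    then have "openin (top_of_set T) ?O"
      using U(1) kc a by (intro openin_group_preimage) auto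
    moreover have "a \<in> ?O" using a kc U(2) by simp
    moreover have const: "k x = k a" if "x \<in> ?O" for x
    proof -
      have x: "x \<in> T" "inv (k a) \<otimes> k x \<in> U" using that by auto
      have "inv (k a) \<otimes> k x \<in> two_torsion G"
        using kc a x by (intro equal_squares) auto
      then have "inv (k a) \<otimes> k x = \<one>" using U(3) x two_torsion_iff by blast
      then show ?thesis
        using kc a x by (metis inv_equality inv_inv inv_closed)
    qed
    moreover have "\<forall>x\<in>?O. \<forall>y\<in>?O. k s = k x \<longrightarrow> k s = k y"
      using const by metis
    ultimately show "\<exists>O'. openin (top_of_set T) O' \<and> a \<in> O' \<and>
        (\<forall>x\<in>O'. \<forall>y\<in>O'. k s = k x \<longrightarrow> k s = k y)"
      by blast
  qed simp
qed

lemma square_locally_injective: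
  assumes x: "x \<in> carrier G"
  shows "\<exists>W. openin (top_of_set (carrier G)) W \<and> x \<in> W \<and> inj_on (\<lambda>y. y \<otimes> y) W"
proof -
  obtain U where U: "openin (top_of_set (carrier G)) U" "\<one> \<in> U"
    "\<And>x. x \<in> U \<Longrightarrow> x \<otimes> x = \<one> \<Longrightarrow> x = \<one>"
    using involutions_isolated by blast
  let ?P = "{p \<in> carrier G \<times> carrier G. inv (fst p) \<otimes> snd p \<in> U}"
  have "continuous_on (carrier G \<times> carrier G) (\<lambda>p. inv (fst p) \<otimes> snd p)"
    by (intro continuous_on_group_mult continuous_on_group_inv continuous_intros) auto
  then have P: "openin (top_of_set (carrier G \<times> carrier G)) ?P"
    using U(1) by (intro openin_group_preimage) auto
  have "(x, x) \<in> ?P" using x U(2) by simp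
  then obtain A B where AB: "openin (top_of_set (carrier G)) A" "x \<in> A"
    "openin (top_of_set (carrier G)) B" "x \<in> B" "A \<times> B \<subseteq> ?P"
    by (rule Times_in_interior_subtopology[OF _ P])
  have "inj_on (\<lambda>y. y \<otimes> y) (A \<inter> B)"
  proof (rule inj_onI)
    fix y z assume yz: "y \<in> A \<inter> B" "z \<in> A \<inter> B" and eq: "y \<otimes> y = z \<otimes> z"
    have c: "y \<in> carrier G" "z \<in> carrier G"
      using yz AB(1) openin_imp_subset by blast+
    have "inv z \<otimes> y \<in> U" using AB(5) yz by auto
    moreover have "inv z \<otimes> y \<in> two_torsion G" using c eq by (intro equal_squares)
    ultimately have "inv z \<otimes> y = \<one>" using U(3) two_torsion_iff by blast
    then show "y = z" using c by (metis inv_equality inv_inv inv_closed)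
  qed
  then show ?thesis using AB by (intro exI[of _ "A \<inter> B"]) auto
qed

end

section \<open>Lifting homotopies through the squaring map\<close>

text \<open>
  For Lie groups \<open>square_open\<close> comes from invariance of domain.
\<close>

locale connected_nilpotent_group_open_squares = connected_nilpotent_group G
  for G :: "('g::topological_space, 'r) monoid_scheme" (structure) +
  assumes square_open:
    "openin (top_of_set (carrier G)) U \<Longrightarrow> openin (top_of_set (carrier G)) ((\<lambda>x. x \<otimes> x) ` U)"
begin

text \<open>
  The products \<open>d\<^sup>2 m\<close> with \<open>m\<close> in the commutator subgroup form a subgroup, which contains the open
  set of all squares and is therefore the whole connected group.
\<close>

lemma square_surjective:
  assumes "y \<in> carrier G"
  shows "\<exists>x\<in>carrier G. x \<otimes> x = y"
proof -
  obtain N where N: "lower_central_series G N = {\<one>}"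
    using nilpotent unfolding nilpotent_group_def by blast
  have "carrier G \<subseteq> square_cosets 0"
  proof (rule connected_subgroup_subset)
    show "openin (top_of_set (carrier G)) ((\<lambda>x. x \<otimes> x) ` carrier G)"
      by (intro square_open) auto
    show "\<one> \<in> (\<lambda>x. x \<otimes> x) ` carrier G"
      by (rule image_eqI[of _ _ \<one>]) auto
    show "(\<lambda>x. x \<otimes> x) ` carrier G \<subseteq> square_cosets 0"
    proof clarify
      fix x assume x: "x \<in> carrier G"
      then have "x \<otimes> x = x \<otimes> x \<otimes> \<one>" by simp
      moreover have "\<one> \<in> lower_central_series G (Suc 0)"
        using lower_central_series_subgroup by (rule subgroup.one_closed)
      ultimately show "x \<otimes> x \<in> square_cosets 0"
        unfolding square_cosets_def using x by fastforce
    qed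
  qed (simp_all add: connected_carrier subgroup_self square_cosets_subgroup)
  then show ?thesis using N assms by (rule square_root_exists)
qed

lemma local_square_root:
  assumes y: "y \<in> carrier G"
  obtains N \<rho> where "openin (top_of_set (carrier G)) N" "y \<in> N" "continuous_on N \<rho>"
    "\<rho> \<in> N \<rightarrow> carrier G" "\<And>z. z \<in> N \<Longrightarrow> \<rho> z \<otimes> \<rho> z = z"
proof -
  let ?sq = "\<lambda>x. x \<otimes> x"
  obtain x where x: "x \<in> carrier G" "x \<otimes> x = y" using square_surjective[OF y] by blast
  obtain W where W: "openin (top_of_set (carrier G)) W" "x \<in> W" "inj_on ?sq W"
    using square_locally_injective[OF x(1)] by blast
  have Wc: "W \<subseteq> carrier G" using W(1) by (rule openin_imp_subset)
  have "continuous_on (?sq ` W) (inv_into W ?sq)"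
  proof (rule continuous_on_inverse_open_map)
    show "continuous_on W ?sq"
      using Wc by (intro continuous_on_group_mult continuous_intros) auto
    show "inv_into W ?sq (?sq z) = z" if "z \<in> W" for z
      using W(3) that by (rule inv_into_f_f)
    fix U assume U: "openin (top_of_set W) U"
    then have "openin (top_of_set (carrier G)) (?sq ` U)"
      using W(1) openin_trans square_open by blast
    then show "openin (top_of_set (?sq ` W)) (?sq ` U)"
      by (rule openin_subset_trans[OF _ image_mono[OF openin_imp_subset[OF U]]
            openin_imp_subset[OF square_open[OF W(1)]]])
  qed simp
  moreover have "inv_into W ?sq \<in> ?sq ` W \<rightarrow> carrier G"
    using Wc by (auto intro!: inv_into_into)
  moreover have "?sq (inv_into W ?sq z) = z" if "z \<in> ?sq ` W" for z
    using that by (rule f_inv_into_f)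
  ultimately show thesis
    using that[of "?sq ` W" "inv_into W ?sq"] square_open[OF W(1)] W(2) x(2) by blast
qed

definition has_square_root :: "('b::topological_space \<Rightarrow> 'g) \<Rightarrow> 'b set \<Rightarrow> bool" where
  "has_square_root h S \<longleftrightarrow>
     (\<exists>k. continuous_on S k \<and> k \<in> S \<rightarrow> carrier G \<and> (\<forall>p\<in>S. k p \<otimes> k p = h p))"

text \<open>
  Two continuous roots of \<open>h\<close> differ by a locally constant function with values in the central
  subgroup of elements of order at most 2, so on a connected overlap they can be made to agree.
\<close>

lemma has_square_root_Un:
  assumes S: "closed S" "has_square_root h S" and T: "closed T" "has_square_root h T"
    and ST: "connected (S \<inter> T)"
  shows "has_square_root h (S \<union> T)"
proof -
  obtain f where f: "continuous_on S f" "f \<in> S \<rightarrow> carrier G" "\<And>p. p \<in> S \<Longrightarrow> f p \<otimes> f p = h p"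
    using S(2) unfolding has_square_root_def by blast
  obtain g where g: "continuous_on T g" "g \<in> T \<rightarrow> carrier G" "\<And>p. p \<in> T \<Longrightarrow> g p \<otimes> g p = h p"
    using T(2) unfolding has_square_root_def by blast
  have tors: "inv (g p) \<otimes> f p \<in> two_torsion G" if "p \<in> S \<inter> T" for p
    using that f g by (intro equal_squares) auto
  define k where "k p = inv (g p) \<otimes> f p" for p
  have "continuous_on (S \<inter> T) k"
    unfolding k_def using f(1,2) g(1,2)
    by (intro continuous_on_group_mult continuous_on_group_inv)
      (auto intro: continuous_on_subset)
  then have kconst: "k p = k q" if "p \<in> S \<inter> T" "q \<in> S \<inter> T" for p q
    using tors that unfolding k_def by (intro two_torsion_valued_constant[OF ST]) auto
  obtain d where d: "d \<in> two_torsion G" and kd: "\<And>p. p \<in> S \<inter> T \<Longrightarrow> k p = d"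
  proof (cases "S \<inter> T = {}")
    case True
    have "\<one> \<in> two_torsion G" by (simp add: two_torsion_iff)
    with True show thesis using that by blast
  next
    case False
    then obtain q where "q \<in> S \<inter> T" by blast
    then show thesis using that[of "k q"] kconst tors unfolding k_def by blast
  qed
  have dcomm: "d \<otimes> x = x \<otimes> d" if "x \<in> carrier G" for x
    using d two_torsion_central that unfolding group_center_def by blast
  have d: "d \<in> carrier G" "d \<otimes> d = \<one>"
    using d two_torsion_iff by auto
  have agree: "f p = g p \<otimes> d" if p: "p \<in> S \<inter> T" for p
  proof -
    have "g p \<otimes> (inv (g p) \<otimes> f p) = g p \<otimes> d"
      using kd[OF p] unfolding k_def by simp
    then show ?thesis using f(2) g(2) p by (simp add: cancel_inv_left Pi_iff)
  qed
  have gd: "continuous_on T (\<lambda>p. g p \<otimes> d)"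
    using g(1,2) d(1) by (intro continuous_on_group_mult continuous_intros) auto
  have "continuous_on (T \<union> S) (\<lambda>p. if p \<notin> S then g p \<otimes> d else f p)"
    using agree by (intro continuous_on_cases S(1) T(1) gd f(1)) auto
  moreover have "(\<lambda>p. if p \<notin> S then g p \<otimes> d else f p) \<in> T \<union> S \<rightarrow> carrier G"
    using f(2) g(2) d(1) by (auto simp: Pi_iff)
  moreover have "(g p \<otimes> d) \<otimes> (g p \<otimes> d) = h p" if p: "p \<in> T" for p
  proof -
    have gp: "g p \<in> carrier G" using g(2) p by auto
    have "(g p \<otimes> d) \<otimes> (g p \<otimes> d) = g p \<otimes> (d \<otimes> g p) \<otimes> d"
      using gp d(1) by (simp add: m_assoc)
    also have "\<dots> = (g p \<otimes> g p) \<otimes> (d \<otimes> d)"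
      unfolding dcomm[OF gp] using gp d(1) by (simp add: m_assoc)
    also have "\<dots> = h p" using d(2) gp unfolding g(3)[OF p, symmetric] by simp
    finally show ?thesis .
  qed
  ultimately show ?thesis
    unfolding has_square_root_def using f(3)
    by (intro exI[of _ "\<lambda>p. if p \<notin> S then g p \<otimes> d else f p"]) (auto simp: Un_commute)
qed

text \<open>
  Near every point of the square \<open>h\<close> has a continuous root.  Rectangles with a common edge can be
  joined, so a subdivision argument yields roots first on thin strips across the square and then on
  the whole square; Bolzano's lemma, applied once in each direction, organises the subdivision.
\<close>

lemma has_square_root_unit_square:
  fixes h :: "real \<times> real \<Rightarrow> 'g"
  assumes h: "continuous_on ({0..1} \<times> {0..1}) h" "h \<in> {0..1} \<times> {0..1} \<rightarrow> carrier G"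
  shows "has_square_root h ({0..1} \<times> {0..1})"
proof -
  \<comment> \<open>Intersecting with the unit interval lets the subdivision intervals stick out of it.\<close>
  define J :: "real \<Rightarrow> real \<Rightarrow> real set" where "J a b = {a..b} \<inter> {0..1}" for a b
  have closed: "closed (J a b \<times> J c d)" for a b c d
    unfolding J_def by (intro closed_Times closed_Int) auto
  have conn: "connected (J a b \<times> J c d)" for a b c d
    unfolding J_def by (intro connected_Times convex_connected convex_Int) auto
  have J_Un: "J a b \<union> J b c = J a c" "J a b \<inter> J b c = J b b" if "a \<le> b" "b \<le> c" for a b c
    using that unfolding J_def by auto
  have paste:
    "\<lbrakk>a \<le> b; b \<le> c; has_square_root h (J a b \<times> J d e); has_square_root h (J b c \<times> J d e)\<rbrakk>
      \<Longrightarrow> has_square_root h (J a c \<times> J d e)"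
    "\<lbrakk>a \<le> b; b \<le> c; has_square_root h (J d e \<times> J a b); has_square_root h (J d e \<times> J b c)\<rbrakk>
      \<Longrightarrow> has_square_root h (J d e \<times> J a c)" for a b c d e
  proof -
    assume abc: "a \<le> b" "b \<le> c"
    have 1: "J a b \<times> J d e \<union> J b c \<times> J d e = J a c \<times> J d e"
      "(J a b \<times> J d e) \<inter> (J b c \<times> J d e) = J b b \<times> J d e"
      using J_Un[OF abc] by blast+
    show "has_square_root h (J a c \<times> J d e)"
      if "has_square_root h (J a b \<times> J d e)" "has_square_root h (J b c \<times> J d e)"
      using has_square_root_Un[OF closed that(1) closed that(2)] conn unfolding 1 by blast
    have 2: "J d e \<times> J a b \<union> J d e \<times> J b c = J d e \<times> J a c"
      "(J d e \<times> J a b) \<inter> (J d e \<times> J b c) = J d e \<times> J b b"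
      using J_Un[OF abc] by blast+
    show "has_square_root h (J d e \<times> J a c)"
      if "has_square_root h (J d e \<times> J a b)" "has_square_root h (J d e \<times> J b c)"
      using has_square_root_Un[OF closed that(1) closed that(2)] conn unfolding 2 by blast
  qed
  have local: "\<exists>e>0. \<forall>a b c d. a \<le> t \<and> t \<le> b \<and> b - a < e \<and> c \<le> x \<and> x \<le> d \<and> d - c < e \<longrightarrow>
      has_square_root h (J a b \<times> J c d)"
    if t: "0 \<le> t" "t \<le> 1" and x: "0 \<le> x" "x \<le> 1" for t x
  proof -
    have "h (t, x) \<in> carrier G" using h(2) t x by auto
    then obtain N \<rho> where N: "openin (top_of_set (carrier G)) N" "h (t, x) \<in> N" "continuous_on N \<rho>"
      "\<rho> \<in> N \<rightarrow> carrier G" "\<And>z. z \<in> N \<Longrightarrow> \<rho> z \<otimes> \<rho> z = z"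
      using local_square_root by blast
    let ?M = "{p \<in> {0..1} \<times> {0..1}. h p \<in> N}"
    have "openin (top_of_set ({0..1} \<times> {0..1})) ?M"
      using h N(1) by (rule openin_group_preimage)
    moreover have "(t, x) \<in> ?M" using t x N(2) by simp
    ultimately obtain e where e: "e > 0" "ball (t, x) e \<inter> ({0..1} \<times> {0..1}) \<subseteq> ?M"
      unfolding openin_contains_ball by (elim conjE) (drule bspec, assumption, blast)
    have "has_square_root h (J a b \<times> J c d)"
      if ab: "a \<le> t" "t \<le> b" "b - a < e / 2" and cd: "c \<le> x" "x \<le> d" "d - c < e / 2"
      for a b c d
    proof -
      have sub: "p \<in> {0..1} \<times> {0..1} \<and> h p \<in> N" if p: "p \<in> J a b \<times> J c d" for p
      proof -
        obtain s y where sy: "p = (s, y)" "s \<in> J a b" "y \<in> J c d" using p by blast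
        have "\<bar>t - s\<bar> + \<bar>x - y\<bar> < e"
          using sy ab cd unfolding J_def by auto
        moreover have "dist (t, x) (s, y) \<le> \<bar>t - s\<bar> + \<bar>x - y\<bar>"
          using sqrt_sum_squares_le_sum_abs[of "t - s" "x - y"]
          by (simp add: dist_Pair_Pair dist_real_def)
        moreover have "p \<in> {0..1} \<times> {0..1}" using sy unfolding J_def by auto
        ultimately have "p \<in> ball (t, x) e \<inter> ({0..1} \<times> {0..1})"
          by (simp add: sy(1))
        then show ?thesis using e(2) by blast
      qed
      have "continuous_on (J a b \<times> J c d) (\<lambda>p. \<rho> (h p))"
        using sub by (intro continuous_on_compose2[OF N(3)] continuous_on_subset[OF h(1)]) auto
      then show ?thesis
        unfolding has_square_root_def using sub N(4,5)
        by (intro exI[of _ "\<lambda>p. \<rho> (h p)"]) auto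
    qed
    then show ?thesis using e(1) by (intro exI[of _ "e / 2"]) auto
  qed
  have strip: "\<exists>e>0. \<forall>a b. a \<le> t \<and> t \<le> b \<and> b - a < e \<longrightarrow> has_square_root h (J a b \<times> J 0 1)"
    if t: "0 \<le> t" "t \<le> 1" for t
  proof -
    define Q where "Q c d \<longleftrightarrow>
      (\<exists>e>0. \<forall>a b. a \<le> t \<and> t \<le> b \<and> b - a < e \<longrightarrow> has_square_root h (J a b \<times> J c d))" for c d
    have "Q 0 1"
    proof (rule Bolzano[where P = Q])
      fix c d f :: real
      assume Q: "Q c d" "Q d f" and cdf: "c \<le> d" "d \<le> f"
      obtain e1 where e1: "e1 > 0"
        "\<And>a b. a \<le> t \<and> t \<le> b \<and> b - a < e1 \<Longrightarrow> has_square_root h (J a b \<times> J c d)"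
        using Q(1) unfolding Q_def by blast
      obtain e2 where e2: "e2 > 0"
        "\<And>a b. a \<le> t \<and> t \<le> b \<and> b - a < e2 \<Longrightarrow> has_square_root h (J a b \<times> J d f)"
        using Q(2) unfolding Q_def by blast
      have "has_square_root h (J a b \<times> J c f)" if "a \<le> t \<and> t \<le> b \<and> b - a < min e1 e2" for a b
        using paste(2)[OF cdf e1(2) e2(2)] that by simp
      then show "Q c f"
        unfolding Q_def using e1(1) e2(1) by (intro exI[of _ "min e1 e2"]) simp
    next
      fix x :: real
      assume "0 \<le> x" "x \<le> 1"
      then obtain e where e: "e > 0"
        "\<And>a b c d. a \<le> t \<and> t \<le> b \<and> b - a < e \<and> c \<le> x \<and> x \<le> d \<and> d - c < e \<Longrightarrow>
           has_square_root h (J a b \<times> J c d)"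
        using local[OF t, of x] by blast
      then have "Q c d" if "c \<le> x \<and> x \<le> d \<and> d - c < e" for c d
        unfolding Q_def using that by blast
      then show "\<exists>e>0. \<forall>c d. c \<le> x \<and> x \<le> d \<and> d - c < e \<longrightarrow> Q c d"
        using e(1) by blast
    qed simp
    then show ?thesis unfolding Q_def .
  qed
  have "has_square_root h (J 0 1 \<times> J 0 1)"
  proof (rule Bolzano[where P = "\<lambda>a b. has_square_root h (J a b \<times> J 0 1)"])
    show "has_square_root h (J a c \<times> J 0 1)"
      if "has_square_root h (J a b \<times> J 0 1)" "has_square_root h (J b c \<times> J 0 1)" "a \<le> b" "b \<le> c"
      for a b c
      using paste(1)[OF that(3,4,1,2)] .
  qed (simp_all add: strip)
  then show ?thesis unfolding J_def by simp
qed

text \<open>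
  Let \<open>h\<close> be a null-homotopy of the loop \<open>p\<^sup>2\<close> and \<open>k\<close> a continuous root of \<open>h\<close>.  On the side where \<open>h = p\<^sup>2\<close>,
  \<open>k\<close> is a translate of \<open>p\<close>; on the side where \<open>h = 1\<close>, it is constant.  The two ends of
  \<open>k(s, _)\<close> are roots of the same element, so their quotient lies in \<open>G[2]\<close> and is constant in \<open>s\<close>.
  It is \<open>1\<close> for \<open>s = 1\<close>, hence also for \<open>s = 0\<close>, and \<open>p\<close> is closed.
\<close>

lemma simply_connected_two_torsion_trivial:
  assumes sc: "simply_connected (carrier G)"
  shows "two_torsion G = {\<one>}"
proof -
  have "g = \<one>" if "g \<in> two_torsion G" for g
  proof -
    have g: "g \<in> carrier G" "g \<otimes> g = \<one>" using that two_torsion_iff by auto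
    have const: "path (\<lambda>_::real. x)" "pathfinish (\<lambda>_. x) = pathstart (\<lambda>_. x)"
      "path_image (\<lambda>_. x) \<subseteq> carrier G" if "x \<in> carrier G" for x
      using that by (auto simp: path_def path_image_def pathfinish_def pathstart_def)
    have "homotopic_loops (carrier G) (\<lambda>_. \<one>) (\<lambda>_. g)"
      using sc const[of \<one>] const[of g] g(1) unfolding simply_connected_def by simp
    then have "path_component (carrier G) \<one> g"
      using homotopic_loops_imp_path_component_value[of _ _ _ 0] by fastforce
    then obtain p where p: "path p" "path_image p \<subseteq> carrier G" "pathstart p = \<one>" "pathfinish p = g"
      unfolding path_component_def by blast
    have pc: "continuous_on {0..1} p" "p \<in> {0..1} \<rightarrow> carrier G" "p 0 = \<one>" "p 1 = g"
      using p by (auto simp: path_def path_image_def pathfinish_def pathstart_def)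
    define q where "q t = p t \<otimes> p t" for t
    have "path q"
      unfolding path_def q_def using pc by (intro continuous_on_group_mult) auto
    moreover have "pathfinish q = pathstart q"
      using pc g by (simp add: q_def pathfinish_def pathstart_def)
    moreover have "path_image q \<subseteq> carrier G"
      using pc(2) by (auto simp: q_def path_image_def)
    ultimately have "homotopic_loops (carrier G) q (\<lambda>_. \<one>)"
      using sc const[of \<one>] unfolding simply_connected_def by simp
    then obtain h :: "real \<times> real \<Rightarrow> 'g"
      where h: "continuous_on ({0..1} \<times> {0..1}) h" "h \<in> {0..1} \<times> {0..1} \<rightarrow> carrier G"
      and h': "\<forall>t\<in>{0..1}. h (0, t) = q t" "\<forall>t\<in>{0..1}. h (1, t) = \<one>"
      "\<forall>s\<in>{0..1}. pathfinish (h \<circ> Pair s) = pathstart (h \<circ> Pair s)"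
      unfolding homotopic_loops by blast
    have h'': "\<forall>s\<in>{0..1}. h (s, 1) = h (s, 0)"
      using h'(3) by (simp add: pathfinish_def pathstart_def)
    obtain k where k: "continuous_on ({0..1} \<times> {0..1}) k" "k \<in> {0..1} \<times> {0..1} \<rightarrow> carrier G"
      "\<And>z. z \<in> {0..1} \<times> {0..1} \<Longrightarrow> k z \<otimes> k z = h z"
      using has_square_root_unit_square[OF h(1,2)] unfolding has_square_root_def by blast
    have kc: "k (s, t) \<in> carrier G" if "s \<in> {0..1}" "t \<in> {0..1}" for s t
      using k(2) that by auto
    have cont1: "continuous_on {0..1} (\<lambda>t. k (s, t))" if "s \<in> {0..1}" for s
      using that by (intro continuous_on_compose2[OF k(1)] continuous_intros) auto
    have cont2: "continuous_on {0..1} (\<lambda>s. k (s, t))" if "t \<in> {0..1}" for t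
      using that by (intro continuous_on_compose2[OF k(1)] continuous_intros) auto
    have I: "connected {0..1::real}" "(0::real) \<in> {0..1}" "(1::real) \<in> {0..1}" by auto
    have bottom: "inv (p 0) \<otimes> k (0, 0) = inv (p 1) \<otimes> k (0, 1)"
    proof (rule two_torsion_valued_constant[OF I(1) _ _ I(2,3)])
      show "continuous_on {0..1} (\<lambda>t. inv (p t) \<otimes> k (0, t))"
        using pc cont1 kc by (intro continuous_on_group_mult continuous_on_group_inv) auto
      show "(\<lambda>t. inv (p t) \<otimes> k (0, t)) \<in> {0..1} \<rightarrow> two_torsion G"
        using pc(2) kc k(3) h'(1) by (auto intro!: equal_squares simp: q_def)
    qed
    have top: "k (1, 0) = k (1, 1)"
    proof (rule two_torsion_valued_constant[OF I(1) _ _ I(2,3)])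
      show "(\<lambda>t. k (1, t)) \<in> {0..1} \<rightarrow> two_torsion G"
        using kc k(3) h'(2) by (auto simp: two_torsion_iff)
    qed (simp add: cont1)
    have "inv (k (0, 0)) \<otimes> k (0, 1) = inv (k (1, 0)) \<otimes> k (1, 1)"
    proof (rule two_torsion_valued_constant[OF I(1) _ _ I(2,3)])
      show "continuous_on {0..1} (\<lambda>s. inv (k (s, 0)) \<otimes> k (s, 1))"
        using cont2 kc by (intro continuous_on_group_mult continuous_on_group_inv) auto
      show "(\<lambda>s. inv (k (s, 0)) \<otimes> k (s, 1)) \<in> {0..1} \<rightarrow> two_torsion G"
        using kc k(3) h'' by (auto intro!: equal_squares)
    qed
    also have "\<dots> = \<one>" using top kc by simp
    finally have "k (0, 0) \<otimes> (inv (k (0, 0)) \<otimes> k (0, 1)) = k (0, 0)" using kc by simp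
    then have "k (0, 1) = k (0, 0)" using kc by (simp add: cancel_inv_left)
    then have "inv g \<otimes> k (0, 0) = \<one> \<otimes> k (0, 0)"
      using bottom kc pc by simp
    then have "inv g = \<one>" using right_cancel[of "k (0, 0)" "inv g" \<one>] kc g(1) by simp
    then show "g = \<one>" using g(1) by (metis inv_inv inv_one)
  qed
  moreover have "\<one> \<in> two_torsion G" by (simp add: two_torsion_iff)
  ultimately show ?thesis by blast
qed

end

section \<open>Lie groups\<close>

context smooth_manifold
begin

lemma chart_at:
  assumes "x \<in> M"
  obtains U \<phi> where "(U, \<phi>) \<in> A" "x \<in> U"
  using assms charts_cover by blast

text \<open>
  In charts this is invariance of domain: both chart images are open in the same model space \<open>V\<close>.
\<close>

lemma locally_injective_imp_open:
  assumes f: "continuous_on M f" "f \<in> M \<rightarrow> M"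
    and inj: "\<And>x. x \<in> M \<Longrightarrow> \<exists>W. openin (top_of_set M) W \<and> x \<in> W \<and> inj_on f W"
    and U: "openin (top_of_set M) U"
  shows "openin (top_of_set M) (f ` U)"
proof (subst openin_subopen, intro ballI)
  fix y assume "y \<in> f ` U"
  then obtain x where x: "x \<in> U" "y = f x" by blast
  then have xM: "x \<in> M" "f x \<in> M" using openin_imp_subset[OF U] f(2) by auto
  obtain C \<phi> where C: "(C, \<phi>) \<in> A" "x \<in> C" using chart_at[OF xM(1)] .
  obtain D \<psi> where D: "(D, \<psi>) \<in> A" "f x \<in> D" using chart_at[OF xM(2)] .
  obtain W where W: "openin (top_of_set M) W" "x \<in> W" "inj_on f W" using inj[OF xM(1)] by blast
  have homC: "homeomorphism C (\<phi> ` C) \<phi> (inv_into C \<phi>)"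
    and homD: "homeomorphism D (\<psi> ` D) \<psi> (inv_into D \<psi>)"
    using C(1) D(1) by (auto intro: chart_homeomorphism)
  define R where "R = U \<inter> W \<inter> C \<inter> (M \<inter> f -` D)"
  have R: "openin (top_of_set M) R"
    unfolding R_def using U W(1) chart_domain[OF C(1)] chart_domain[OF D(1)] f
    by (intro openin_Int continuous_openin_preimage)
  have RC: "R \<subseteq> C" "R \<subseteq> M" "f ` R \<subseteq> D" "R \<subseteq> W" unfolding R_def by auto
  let ?g = "\<lambda>v. \<psi> (f (inv_into C \<phi> v))"
  have inv: "inv_into C \<phi> (\<phi> z) = z" if "z \<in> C" for z
    using homeomorphism_apply1[OF homC that] .
  have invD: "inv_into D \<psi> (\<psi> z) = z" if "z \<in> D" for z
    using homeomorphism_apply1[OF homD that] .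
  have S: "openin (top_of_set V) (\<phi> ` R)"
  proof -
    have "openin (top_of_set C) R"
      using R RC(1) openin_imp_subset[OF chart_domain[OF C(1)]] by (rule openin_subset_trans)
    then have "openin (top_of_set (\<phi> ` C)) (\<phi> ` R)"
      by (rule homeomorphism_imp_open_map[OF homC])
    then show ?thesis using chart_image[OF C(1)] by (rule openin_trans)
  qed
  have gS: "?g ` \<phi> ` R = \<psi> ` f ` R"
    using RC(1) inv by (force simp: image_image)
  have "openin (top_of_set V) (?g ` \<phi> ` R)"
  proof (rule invariance_of_domain_subspaces[OF S model_subspace model_subspace order_refl])
    have imR: "inv_into C \<phi> ` \<phi> ` R = R"
      using RC(1) inv by (force simp: image_image)
    have "continuous_on (\<phi> ` R) (inv_into C \<phi>)"
      using homeomorphism_cont2[OF homC] RC(1) by (rule continuous_on_subset[OF _ image_mono])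
    then have "continuous_on (\<phi> ` R) (\<lambda>v. f (inv_into C \<phi> v))"
      using imR by (intro continuous_on_compose2[OF continuous_on_subset[OF f(1) RC(2)]]) simp_all
    moreover have "(\<lambda>v. f (inv_into C \<phi> v)) ` \<phi> ` R \<subseteq> D"
      using imR RC(3) by (metis image_image)
    ultimately show "continuous_on (\<phi> ` R) ?g"
      by (intro continuous_on_compose2[OF homeomorphism_cont1[OF homD]])
    show "?g \<in> \<phi> ` R \<rightarrow> V"
      using gS RC(3) openin_imp_subset[OF chart_image[OF D(1)]] by blast
    show "inj_on ?g (\<phi> ` R)"
    proof (rule inj_onI)
      fix v w assume v: "v \<in> \<phi> ` R" and w: "w \<in> \<phi> ` R" and eq: "?g v = ?g w"
      obtain a where a: "a \<in> R" "v = \<phi> a" using v by blast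
      obtain b where b: "b \<in> R" "w = \<phi> b" using w by blast
      have "\<psi> (f a) = \<psi> (f b)"
        using eq unfolding a(2) b(2) inv[OF subsetD[OF RC(1) a(1)]] inv[OF subsetD[OF RC(1) b(1)]] .
      then have "inv_into D \<psi> (\<psi> (f a)) = inv_into D \<psi> (\<psi> (f b))" by simp
      then have "f a = f b" using invD RC(3) a(1) b(1) by (metis image_subset_iff)
      then have "a = b" using inj_onD[OF W(3)] RC(4) a(1) b(1) by blast
      then show "v = w" using a b by simp
    qed
  qed
  then have "openin (top_of_set (\<psi> ` D)) (\<psi> ` f ` R)"
    unfolding gS
    by (rule openin_subset_trans[OF _ image_mono[OF RC(3)] openin_imp_subset[OF chart_image[OF D(1)]]])
  then have "openin (top_of_set D) (inv_into D \<psi> ` \<psi> ` f ` R)"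
    by (rule homeomorphism_imp_open_map[OF homeomorphism_symD[OF homD]])
  moreover have "inv_into D \<psi> ` \<psi> ` f ` R = f ` R"
    using RC(3) invD by (force simp: image_image)
  ultimately have "openin (top_of_set M) (f ` R)"
    using chart_domain[OF D(1)] openin_trans by metis
  moreover have "y \<in> f ` R" unfolding R_def using x xM W(2) C(2) D(2) by auto
  moreover have "f ` R \<subseteq> f ` U" unfolding R_def by auto
  ultimately show "\<exists>T. openin (top_of_set M) T \<and> y \<in> T \<and> T \<subseteq> f ` U" by blast
qed

end

context lie_group
begin

lemma topological_group: "topological_group G"
  using smooth_mult smooth_inv by unfold_locales (auto simp: smooth_map_def)

text \<open>
  In a chart with \<open>p\<close> the image of \<open>\<one>\<close>, the derivative \<open>D\<close> of the multiplication at \<open>(p, p)\<close> satisfies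
  \<open>D(u, u) = D(u, 0) + D(0, u) = 2u + o(u)\<close>, since \<open>x \<one> = \<one> x = x\<close>.  If \<open>p + u\<close> is the image of an
  involution, then also \<open>D(u, u) = o(u)\<close>, which forces \<open>u = 0\<close> when \<open>u\<close> is small.
\<close>

lemma involutions_isolated:
  "\<exists>U. openin (top_of_set (carrier G)) U \<and> \<one> \<in> U \<and> (\<forall>x\<in>U. x \<otimes> x = \<one> \<longrightarrow> x = \<one>)"
proof -
  obtain U \<phi> where U: "(U, \<phi>) \<in> A" "\<one> \<in> U" using chart_at[OF one_closed] .
  have UG: "U \<subseteq> carrier G" using openin_imp_subset[OF chart_domain[OF U(1)]] .
  have hom: "homeomorphism U (\<phi> ` U) \<phi> (inv_into U \<phi>)" using U(1) by (rule chart_homeomorphism)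
  have inj: "inj_on \<phi> U"
    using homeomorphism_apply1[OF hom] by (rule inj_on_inverseI)
  define p where "p = \<phi> \<one>"
  define S where "S = map_prod \<phi> \<phi> ` (U \<times> U \<inter> (\<lambda>(x, y). x \<otimes> y) -` U)"
  define F where "F = \<phi> \<circ> (\<lambda>(x, y). x \<otimes> y) \<circ> inv_into (U \<times> U) (map_prod \<phi> \<phi>)"
  have "(U \<times> U, map_prod \<phi> \<phi>) \<in> prod_atlas A A"
    unfolding prod_atlas_def using U(1) by blast
  then have "smooth_on (V \<times> V) S F"
    using smooth_mult U(1) unfolding smooth_map_def S_def F_def by fast
  then have "Ck_on (Suc 0) (V \<times> V) S F" unfolding smooth_on_def by blast
  then obtain F' where F': "\<And>z. z \<in> S \<Longrightarrow> (F has_derivative F' z) (at z within S)"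
    unfolding Ck_on.simps by blast
  have S: "(\<phi> x, \<phi> y) \<in> S" if "x \<in> U" "y \<in> U" "x \<otimes> y \<in> U" for x y
    unfolding S_def using that by (intro image_eqI[of _ _ "(x, y)"]) auto
  have F: "F (\<phi> x, \<phi> y) = \<phi> (x \<otimes> y)" if "x \<in> U" "y \<in> U" for x y
  proof -
    have "inv_into (U \<times> U) (map_prod \<phi> \<phi>) (map_prod \<phi> \<phi> (x, y)) = (x, y)"
      using inj that by (intro inv_into_f_f map_prod_inj_on) auto
    then show ?thesis unfolding F_def by simp
  qed
  define D where "D = F' (p, p)"
  have D: "(F has_derivative D) (at (p, p) within S)"
    unfolding D_def p_def using U(2) by (intro F' S) auto
  then have lin: "bounded_linear D" by (rule has_derivative_bounded_linear)
  \<comment> \<open>Any constant below \<open>1/2\<close> would do: the errors of \<open>D(u, u)\<close>, \<open>D(u, 0)\<close> and \<open>D(0, u)\<close> must add up to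
    less than \<open>2\<close> times the norm of \<open>u\<close>, and the pair \<open>(u, u)\<close> has at most twice that norm.\<close>
  obtain d where d: "d > 0"
    "\<And>z. z \<in> S \<Longrightarrow> norm (z - (p, p)) < d \<Longrightarrow>
       norm (F z - F (p, p) - D (z - (p, p))) \<le> 1 / 4 * norm (z - (p, p))"
    using D unfolding has_derivative_within_alt by (meson zero_less_divide_1_iff zero_less_numeral)
  have Fp: "F (p, p) = p" unfolding p_def using F[OF U(2) U(2)] by simp
  have "openin (top_of_set U) (U \<inter> \<phi> -` ball p (d / 2))"
    using homeomorphism_cont1[OF hom] by (rule continuous_openin_preimage_gen) simp
  then have "openin (top_of_set (carrier G)) (U \<inter> \<phi> -` ball p (d / 2))"
    using chart_domain[OF U(1)] by (rule openin_trans)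
  moreover have "\<one> \<in> U \<inter> \<phi> -` ball p (d / 2)" using U(2) d(1) by (simp add: p_def)
  moreover have "x = \<one>" if x: "x \<in> U \<inter> \<phi> -` ball p (d / 2)" and sq: "x \<otimes> x = \<one>" for x
  proof -
    have xU: "x \<in> U" "x \<in> carrier G" using x UG by auto
    define u where "u = \<phi> x - p"
    have u: "norm u < d / 2"
      using x by (simp add: u_def dist_norm norm_minus_commute)
    then have u': "norm u < d" using d(1) by simp
    have nuu: "norm (u, u) \<le> 2 * norm u"
      using norm_Pair_le[of u u] by simp
    have est: "norm (\<phi> (a \<otimes> b) - p - D (\<phi> a - p, \<phi> b - p)) \<le> 1 / 4 * norm (\<phi> a - p, \<phi> b - p)"
      if "a \<in> U" "b \<in> U" "a \<otimes> b \<in> U" "norm (\<phi> a - p, \<phi> b - p) < d" for a b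
      using d(2)[OF S[OF that(1-3)]] that Fp F by simp
    have "norm (- D (u, u)) \<le> 1 / 4 * norm (u, u)"
      using est[OF xU(1) xU(1)] sq U(2) u nuu by (simp add: u_def p_def del: norm_minus_cancel)
    then have "norm (D (u, u)) \<le> 1 / 2 * norm u"
      using nuu by simp
    moreover have "norm (u - D (u, 0)) \<le> 1 / 4 * norm u"
      using est[OF xU(1) U(2)] xU u' by (simp add: u_def p_def norm_Pair)
    moreover have "norm (u - D (0, u)) \<le> 1 / 4 * norm u"
      using est[OF U(2) xU(1)] xU u' by (simp add: u_def p_def norm_Pair)
    moreover have "D (u, u) = D (u, 0) + D (0, u)"
      using linear_add[OF bounded_linear.linear[OF lin], of "(u, 0)" "(0, u)"] by simp
    then have "u + u = D (u, u) + (u - D (u, 0)) + (u - D (0, u))" by simp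
    then have "norm (u + u) \<le> norm (D (u, u)) + norm (u - D (u, 0)) + norm (u - D (0, u))"
      by (metis norm_triangle_ineq norm_triangle_le add_mono order_refl)
    moreover have "norm (u + u) = 2 * norm u"
      by (metis norm_scaleR scaleR_2 abs_numeral)
    ultimately have "norm u \<le> 0" by linarith
    then have "\<phi> x = \<phi> \<one>" by (simp add: u_def p_def)
    then show "x = \<one>" using inj xU(1) U(2) by (simp add: inj_on_eq_iff)
  qed
  ultimately show ?thesis by blast
qed

lemma connected_nilpotent_group_open_squares:
  assumes "connected (carrier G)" "nilpotent_group G"
  shows "connected_nilpotent_group_open_squares G"
proof -
  interpret connected_nilpotent_group G
    using topological_group involutions_isolated assms
    by (simp add: connected_nilpotent_group_def connected_nilpotent_group_axioms_def)
  have "continuous_on (carrier G) (\<lambda>x. x \<otimes> x)"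
    by (intro continuous_on_group_mult continuous_intros) auto
  then show ?thesis
    using square_locally_injective
    by unfold_locales (rule locally_injective_imp_open, auto)
qed

end

theorem lemma4p1:
  fixes G :: "('g::topological_space, 'r) monoid_scheme"
    and V :: "'e::euclidean_space set"
    and A :: "('g, 'e) atlas"
  assumes "lie_group G V A"
    and "connected (carrier G)"
    and "nilpotent_group G"
  shows "(\<forall>g\<in>carrier G. real_element G g \<longleftrightarrow> g [^]\<^bsub>G\<^esub> (2::nat) = \<one>\<^bsub>G\<^esub>)
    \<and> {g. real_element G g} = two_torsion G
    \<and> two_torsion G \<subseteq> group_center G
    \<and> (simply_connected (carrier G) \<longrightarrow> {g. real_element G g} = {\<one>\<^bsub>G\<^esub>})"
proof -
  interpret connected_nilpotent_group_open_squares G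
    using assms by (rule lie_group.connected_nilpotent_group_open_squares)
  show ?thesis
    using real_element_iff real_elements_eq_two_torsion two_torsion_central
      simply_connected_two_torsion_trivial by simp
qed

end
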